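(* Let $a<b$ be real numbers, let $r$ be a positive continuous function on $(a,b)$ and let $p>1$ be an integer. Put $R(x,b)=\int_x^b r(t)\,dt$. Then for all measurable functions $f\ge 0$ on $(a,b)$ such that all integrals below exist and are finite, $$\int_a^b r(x)\left(\int_a^x f(t)\,dt\right)^{p+1}dx\le C\left(\int_a^b (f(x))^{\frac{p(p+1)}{p-1}}\,dx\right)^{\frac{p-1}{p}},$$ where $$C=(p+1)^{\frac1p}(b-a)^p\left(\int_a^b R^p(x,b)\,dx\right)^{\frac1p}.$$
   Context: Standing assumption: all functions are measurable and all the integrals appearing in the inequality and in $C$ (including those defining $R(x,b)$ and $\int_a^x f$ for $x\in(a,b)$) exist and are finite. $R^p(x,b)$ means $(R(x,b))^p$. *)

theory Defs
  imports "HOL-Analysis.Analysis"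
begin

text \<open>
  All integrals are Lebesgue integrals over open intervals; the endpoints are null sets, and
  the functions involved are only constrained on the open interval \<open>(a, b)\<close>.
\<close>

definition tail_integral :: "(real \<Rightarrow> real) \<Rightarrow> real \<Rightarrow> real \<Rightarrow> real"
  where "tail_integral r b x = (LINT t:{x<..<b}|lebesgue. r t)"

definition primitive_from :: "real \<Rightarrow> (real \<Rightarrow> real) \<Rightarrow> real \<Rightarrow> real"
  where "primitive_from a f x = (LINT t:{a<..<x}|lebesgue. f t)"

definition opial_const :: "real \<Rightarrow> real \<Rightarrow> (real \<Rightarrow> real) \<Rightarrow> nat \<Rightarrow> real"
  where "opial_const a b r p =
    (real p + 1) powr (1 / real p) * (b - a) ^ p
      * (LINT x:{a<..<b}|lebesgue. tail_integral r b x ^ p) powr (1 / real p)"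

end

theory Submission
  imports Defs
begin

text \<open>
  Write \<open>F(x)\<close> for the integral of \<open>f\<close> over \<open>(a, x)\<close> and \<open>q = p / (p - 1)\<close>. By the power mean
  inequality, \<open>F(x)\<close> to the power \<open>p + 1\<close> is at most \<open>(b - a)\<close> to the power \<open>p\<close> times the integral
  of the \<open>(p + 1)\<close>-st power of \<open>f\<close> over \<open>(a, x)\<close>. Exchanging the order of integration turns
  the weight \<open>r\<close> into its tail integral \<open>R\<close>, and Hoelder's inequality with exponents \<open>p\<close> and \<open>q\<close>
  separates \<open>R\<close> from \<open>f\<close>. This even gives the constant without the factor
  \<open>(p + 1) powr (1 / p)\<close>, which is at least 1.
\<close>

text \<open>Young's inequality, applied pointwise to \<open>u\<close> and \<open>v\<close> divided
  by their norms, integrates to \<open>1 / p + 1 / q = 1\<close>; multiplying the norms back gives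
  the bound.\<close>

lemma Hoelder_inequality:
  fixes u v :: "'a \<Rightarrow> real" and p q :: real
  assumes pq: "p > 1" "q > 1" "1 / p + 1 / q = 1"
    and u_meas [measurable]: "u \<in> borel_measurable M"
    and v_meas [measurable]: "v \<in> borel_measurable M"
    and u_nonneg: "\<And>x. x \<in> space M \<Longrightarrow> u x \<ge> 0"
    and v_nonneg: "\<And>x. x \<in> space M \<Longrightarrow> v x \<ge> 0"
    and u_int: "integrable M (\<lambda>x. u x powr p)"
    and v_int: "integrable M (\<lambda>x. v x powr q)"
  shows "integrable M (\<lambda>x. u x * v x)"
    and "(LINT x|M. u x * v x)
      \<le> (LINT x|M. u x powr p) powr (1 / p) * (LINT x|M. v x powr q) powr (1 / q)"
proof -
  define A B where "A = (LINT x|M. u x powr p)" and "B = (LINT x|M. v x powr q)"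
  have AB: "A \<ge> 0" "B \<ge> 0"
    unfolding A_def B_def by simp_all
  show int: "integrable M (\<lambda>x. u x * v x)"
  \<comment> \<open>For integrability no normalisation is required: Young's inequality for
    \<open>u\<close> and \<open>v\<close> themselves already provides an integrable
    majorant.\<close>
  proof (rule Bochner_Integration.integrable_bound)
    show "integrable M (\<lambda>x. u x powr p / p + v x powr q / q)"
      using u_int v_int by simp
    show "AE x in M. norm (u x * v x) \<le> norm (u x powr p / p + v x powr q / q)"
    proof (rule AE_I2)
      fix x assume "x \<in> space M"
      then have "u x * v x \<le> u x powr p / p + v x powr q / q" "u x * v x \<ge> 0"
        using Youngs_inequality[of p q "u x" "v x"] pq u_nonneg v_nonneg by auto
      then show "norm (u x * v x) \<le> norm (u x powr p / p + v x powr q / q)"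
        by simp
    qed
  qed simp
  have "(LINT x|M. u x * v x) \<le> A powr (1 / p) * B powr (1 / q)"
  \<comment> \<open>A vanishing norm cannot be divided by. In that case one factor is zero almost
    everywhere, so the product integrates to 0.\<close>
  proof (cases "A = 0 \<or> B = 0")
    case True
    have "AE x in M. u x = 0 \<or> v x = 0"
    proof (cases "A = 0")
      case True
      then have "AE x in M. u x powr p = 0"
        using integral_nonneg_eq_0_iff_AE[OF u_int] by (simp add: A_def)
      then show ?thesis by eventually_elim simp
    next
      case False
      with True have "B = 0" by simp
      then have "AE x in M. v x powr q = 0"
        using integral_nonneg_eq_0_iff_AE[OF v_int] by (simp add: B_def)
      then show ?thesis by eventually_elim simp
    qed
    then have "AE x in M. u x * v x = 0"
      by eventually_elim auto
    then have "(LINT x|M. u x * v x) = 0"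
      by (rule integral_eq_zero_AE)
    then show ?thesis by simp
  next
    case False
    then have pos: "A > 0" "B > 0" using AB by auto
    \<comment> \<open>These are the norms of \<open>u\<close> and \<open>v\<close>; after division
      by them both functions have norm 1.\<close>
    define \<alpha> \<beta> where "\<alpha> = A powr (1 / p)" and "\<beta> = B powr (1 / q)"
    have \<alpha>\<beta>: "\<alpha> > 0" "\<beta> > 0" "\<alpha> powr p = A" "\<beta> powr q = B"
      using pos pq by (simp_all add: \<alpha>_def \<beta>_def powr_powr)
    have "(LINT x|M. u x * v x)
        \<le> (LINT x|M. \<alpha> * \<beta> * (u x powr p / (A * p) + v x powr q / (B * q)))"
    proof (rule integral_mono)
      fix x assume x: "x \<in> space M"
      then have "u x / \<alpha> * (v x / \<beta>) \<le> (u x / \<alpha>) powr p / p + (v x / \<beta>) powr q / q"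
        using u_nonneg v_nonneg \<alpha>\<beta> pq by (intro Youngs_inequality) auto
      also have "\<dots> = u x powr p / (A * p) + v x powr q / (B * q)"
        using u_nonneg[OF x] v_nonneg[OF x] \<alpha>\<beta> by (simp add: powr_divide)
      finally show "u x * v x \<le> \<alpha> * \<beta> * (u x powr p / (A * p) + v x powr q / (B * q))"
        using \<alpha>\<beta> by (simp add: field_simps)
    qed (use int u_int v_int in auto)
    also have "\<dots> = \<alpha> * \<beta> * (A / (A * p) + B / (B * q))"
      using u_int v_int by (simp add: A_def B_def)
    also have "\<dots> = \<alpha> * \<beta>"
      using pos pq by simp
    finally show ?thesis by (simp add: \<alpha>_def \<beta>_def)
  qed
  then show "(LINT x|M. u x * v x)
      \<le> (LINT x|M. u x powr p) powr (1 / p) * (LINT x|M. v x powr q) powr (1 / q)"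
    by (simp add: A_def B_def)
qed

text \<open>This is Hoelder's inequality for \<open>f\<close> and the constant 1 with exponents
  \<open>n + 1\<close> and \<open>(n + 1) / n\<close>, raised to the power
  \<open>n + 1\<close>.\<close>

lemma (in finite_measure) integral_power_le:
  fixes f :: "'a \<Rightarrow> real"
  assumes "n > 0"
    and f_meas: "f \<in> borel_measurable M"
    and f_nonneg: "\<And>x. x \<in> space M \<Longrightarrow> f x \<ge> 0"
    and f_int: "integrable M (\<lambda>x. f x ^ (n + 1))"
  shows "(LINT x|M. f x) ^ (n + 1) \<le> measure M (space M) ^ n * (LINT x|M. f x ^ (n + 1))"
proof -
  define N where "N = real n + 1"
  have N: "N > 1" "N / (N - 1) > 1" "1 / N + 1 / (N / (N - 1)) = 1"
    using \<open>n > 0\<close> by (simp_all add: N_def field_simps)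
  have pow: "x ^ (n + 1) = x powr N" if "x \<ge> 0" for x :: real
    using that powr_realpow'[of x "n + 1"] by (simp add: N_def add.commute)
  have int: "integrable M (\<lambda>x. f x powr N)"
    using f_int by (rule Bochner_Integration.integrable_cong[THEN iffD1, rotated -1])
      (simp_all only: pow f_nonneg)
  have eq: "(LINT x|M. f x powr N) = (LINT x|M. f x ^ (n + 1))"
    by (rule Bochner_Integration.integral_cong) (simp_all only: pow f_nonneg)
  define J \<mu> where "J = (LINT x|M. f x ^ (n + 1))" and "\<mu> = measure M (space M)"
  have J: "J \<ge> 0" unfolding J_def using f_nonneg
    by (intro integral_nonneg_AE AE_I2) simp
  have "(LINT x|M. f x * 1) \<le> J powr (1 / N) * \<mu> powr (1 / (N / (N - 1)))"
    using Hoelder_inequality(2)[OF N f_meas, of "\<lambda>_. 1"] f_nonneg int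
    by (simp add: eq J_def \<mu>_def)
  then have "(LINT x|M. f x) powr N \<le> (J powr (1 / N) * \<mu> powr (1 / (N / (N - 1)))) powr N"
    using N by (intro powr_mono2) (auto intro!: integral_nonneg_AE f_nonneg)
  also have "\<dots> = J * \<mu> powr real n"
    using N J by (simp add: powr_mult powr_powr N_def)
  \<comment> \<open>The two powers differ at exponent 0 and base 0, where
    \<open>0 powr 0 = 0\<close> but \<open>0 ^ 0 = 1\<close>; positivity of \<open>n\<close>
    excludes this.\<close>
  also have "\<mu> powr real n = \<mu> ^ n"
    using \<open>n > 0\<close> by (simp add: \<mu>_def powr_realpow')
  finally show ?thesis
    by (subst pow) (auto intro!: integral_nonneg_AE f_nonneg simp: J_def \<mu>_def mult.commute)
qed

text \<open>For \<open>x \<le> 1\<close> the summand 1 dominates, otherwise the larger exponent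
  does. On a finite measure space this makes lower powers of a function integrable once a higher one
  is.\<close>

lemma powr_mono_one_plus:
  fixes x s t :: real
  assumes "0 \<le> x" "0 \<le> s" "s \<le> t"
  shows "x powr s \<le> 1 + x powr t"
proof (cases "x \<le> 1")
  case True
  then show ?thesis
    using powr_mono2[of s x 1] assms by (simp add: add_increasing2)
next
  case False
  then show ?thesis
    using powr_mono[of s t x] assms by linarith
qed

theorem theorem2p16:
  fixes a b :: real and r f :: "real \<Rightarrow> real" and p :: nat
  assumes "a < b"
    and r_cont: "continuous_on {a<..<b} r"
    and r_pos: "\<And>x. x \<in> {a<..<b} \<Longrightarrow> r x > 0"
    and "p > 1"
    and f_meas: "f \<in> borel_measurable (lebesgue_on {a<..<b})"
    and f_nonneg: "\<And>x. x \<in> {a<..<b} \<Longrightarrow> f x \<ge> 0"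
    and r_int: "\<And>x. x \<in> {a<..<b} \<Longrightarrow> set_integrable lebesgue {x<..<b} r"
    and f_int: "\<And>x. x \<in> {a<..<b} \<Longrightarrow> set_integrable lebesgue {a<..<x} f"
    and R_int: "set_integrable lebesgue {a<..<b} (\<lambda>x. tail_integral r b x ^ p)"
    and lhs_int: "set_integrable lebesgue {a<..<b} (\<lambda>x. r x * primitive_from a f x ^ (p + 1))"
    and rhs_int: "set_integrable lebesgue {a<..<b}
      (\<lambda>x. f x powr (real p * (real p + 1) / (real p - 1)))"
  shows "(LINT x:{a<..<b}|lebesgue. r x * primitive_from a f x ^ (p + 1))
    \<le> opial_const a b r p
      * (LINT x:{a<..<b}|lebesgue. f x powr (real p * (real p + 1) / (real p - 1)))
          powr ((real p - 1) / real p)"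
proof -
  define I where "I = {a<..<b}"
  define M where "M = lebesgue_on I"
  define s where "s = real p * (real p + 1) / (real p - 1)"
  define q where "q = real p / (real p - 1)"
  define F R where "F = primitive_from a f" and "R = tail_integral r b"
  have I [measurable]: "I \<in> sets lebesgue" by (simp add: I_def)
  have space_M: "space M = I" by (simp add: M_def)
  interpret M: finite_measure M
    unfolding M_def I_def by (rule finite_measure_lebesgue_on) simp
  interpret pair_sigma_finite M M ..
  \<comment> \<open>\<open>M\<close> carries the Lebesgue sigma-algebra. Measurability of the
    identity into the Borel sets is what makes the triangle \<open>t < x\<close> measurable in the
    product of \<open>M\<close> with itself, as the exchange of integrals requires.\<close>
  have id_M [measurable]: "(\<lambda>x. x) \<in> borel_measurable M"
    unfolding M_def by (intro measurable_restrict_space1 measurable_completion) simp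
  have f_M [measurable]: "f \<in> borel_measurable M"
    using f_meas by (simp add: M_def I_def)
  have r_M [measurable]: "r \<in> borel_measurable M"
    unfolding M_def I_def
    using r_cont by (intro continuous_imp_measurable_on_sets_lebesgue) auto
  \<comment> \<open>\<open>q\<close> is conjugate to \<open>p\<close>. The identity
    \<open>s = (p + 1) * q\<close> turns the \<open>q\<close>-th power of \<open>f ^ (p + 1)\<close>
    into the integrand on the right, and \<open>1 / q\<close> is the outer exponent there.\<close>
  have pq: "real p > 1" "q > 1" "1 / real p + 1 / q = 1" "s = (real p + 1) * q" "1 / q = (real p - 1) / real p"
    using \<open>p > 1\<close> by (simp_all add: q_def s_def field_simps)
  have set_int: "integrable M g" if "set_integrable lebesgue I g" for g :: "real \<Rightarrow> real"
    using that by (simp add: M_def integrable_restrict_space set_integrable_def)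
  have LINT_M: "(LINT x:I|lebesgue. g x) = (LINT x|M. g x)" for g :: "real \<Rightarrow> real"
    by (simp add: M_def integral_restrict_space set_lebesgue_integral_def)

  have fs_int: "integrable M (\<lambda>x. f x powr s)"
    using rhs_int by (intro set_int) (simp add: I_def s_def)
  \<comment> \<open>Since \<open>p + 1 \<le> s\<close> and \<open>M\<close> is finite,
    \<open>1 + f powr s\<close> is an integrable majorant.\<close>
  have fp_int: "integrable M (\<lambda>x. f x ^ (p + 1))"
  proof (rule Bochner_Integration.integrable_bound)
    show "integrable M (\<lambda>x. 1 + f x powr s)"
      using fs_int by simp
    show "AE x in M. norm (f x ^ (p + 1)) \<le> norm (1 + f x powr s)"
    proof (rule AE_I2)
      fix x assume "x \<in> space M"
      then have f: "f x \<ge> 0" using f_nonneg by (simp add: space_M I_def)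
      have "real p + 1 \<le> s" using pq by simp
      with f have "f x powr (real p + 1) \<le> 1 + f x powr s"
        by (intro powr_mono_one_plus) auto
      moreover have "f x powr (real p + 1) = f x ^ (p + 1)"
        using powr_realpow'[of "f x" "p + 1"] f by (simp add: add.commute)
      ultimately show "norm (f x ^ (p + 1)) \<le> norm (1 + f x powr s)"
        using f by simp
    qed
  qed simp

  \<comment> \<open>The power mean inequality is used on the interval from \<open>a\<close> to
    \<open>x\<close>, whose length is at most \<open>b - a\<close>. The indicator moves the integral
    back to \<open>M\<close>, so that the domain no longer depends on \<open>x\<close>.\<close>
  have F_le: "F x ^ (p + 1) \<le> (b - a) ^ p * (LINT t|M. indicator {..<x} t * f t ^ (p + 1))"
    if x: "x \<in> I" for x
  proof -
    define K where "K = lebesgue_on {a<..<x}"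
    interpret K: finite_measure K
      unfolding K_def by (rule finite_measure_lebesgue_on) simp
    have ind: "indicator I t * indicator {..<x} t = (indicator {a<..<x} t :: real)" for t
      using x by (auto simp: I_def indicator_def)
    have KM: "(LINT t|K. g t) = (LINT t|M. indicator {..<x} t * g t)" for g :: "real \<Rightarrow> real"
      by (simp add: K_def M_def integral_restrict_space ind flip: mult.assoc)
    have int: "integrable K (\<lambda>t. f t ^ (p + 1))"
    proof -
      have "set_integrable lebesgue {a<..<x} (\<lambda>t. f t ^ (p + 1))"
        by (rule set_integrable_subset[of _ I])
          (use fp_int x in \<open>auto simp: M_def I_def integrable_restrict_space set_integrable_def\<close>)
      then show ?thesis
        by (simp add: K_def integrable_restrict_space set_integrable_def)
    qed
    have F: "F x = (LINT t|K. f t)"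
      by (simp add: F_def primitive_from_def K_def integral_restrict_space set_lebesgue_integral_def)
    have meas: "f \<in> borel_measurable K"
      unfolding K_def by (rule measurable_restrict_mono[OF f_meas]) (use x in \<open>auto simp: I_def\<close>)
    have "F x ^ (p + 1) \<le> measure K (space K) ^ p * (LINT t|K. f t ^ (p + 1))"
      unfolding F using \<open>p > 1\<close> meas int x
      by (intro K.integral_power_le) (auto simp: K_def I_def intro!: f_nonneg)
    also have "measure K (space K) = x - a"
      using x by (simp add: K_def I_def measure_restrict_space)
    also have "(x - a) ^ p * (LINT t|K. f t ^ (p + 1)) \<le> (b - a) ^ p * (LINT t|K. f t ^ (p + 1))"
      using x by (intro mult_right_mono power_mono integral_nonneg_AE AE_I2)
        (auto simp: I_def K_def intro!: mult_nonneg_nonneg zero_le_power f_nonneg)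
    finally show ?thesis by (simp add: KM)
  qed

  \<comment> \<open>This is the form in which \<open>R t\<close> appears as the inner integral once
    the order of integration is exchanged.\<close>
  have R_eq: "ennreal (R t) = (\<integral>\<^sup>+x. ennreal (indicator {t<..} x * r x) \<partial>M)" and R_nonneg: "R t \<ge> 0"
    if t: "t \<in> I" for t
  proof -
    have ind: "indicator I x * indicator {t<..} x = (indicator {t<..<b} x :: real)" for x
      using t by (auto simp: I_def indicator_def)
    have int: "integrable M (\<lambda>x. indicator {t<..} x * r x)"
      using r_int[of t] t
      by (simp add: M_def integrable_restrict_space set_integrable_def ind I_def[symmetric] flip: mult.assoc)
    have R: "R t = (LINT x|M. indicator {t<..} x * r x)"
      by (simp add: R_def tail_integral_def M_def integral_restrict_space set_lebesgue_integral_def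
          ind flip: mult.assoc)
    have nonneg: "AE x in M. 0 \<le> indicator {t<..} x * r x"
      using r_pos by (intro AE_I2) (auto simp: space_M I_def less_imp_le)
    show "ennreal (R t) = (\<integral>\<^sup>+x. ennreal (indicator {t<..} x * r x) \<partial>M)"
      unfolding R using nn_integral_eq_integral[OF int nonneg] by simp
    show "R t \<ge> 0"
      unfolding R using nonneg by (rule integral_nonneg_AE)
  qed

  have R_meas: "R \<in> borel_measurable M"
  proof -
    \<comment> \<open>On \<open>I\<close> this function agrees with \<open>R\<close>, and it is
      measurable as a parameter integral of a jointly measurable function.\<close>
    have "(\<lambda>t. enn2real (\<integral>\<^sup>+x. ennreal (indicator {t<..} x * r x) \<partial>M)) \<in> borel_measurable M"
      by (simp add: indicator_def)
    then show ?thesis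
      by (rule measurable_cong[THEN iffD1, rotated]) (simp add: space_M R_nonneg flip: R_eq)
  qed
  have Rp_int: "integrable M (\<lambda>t. R t powr real p)"
  and Rp_eq: "(LINT t|M. R t powr real p) = (LINT t|M. R t ^ p)"
  proof -
    have eq: "R t powr real p = R t ^ p" if "t \<in> space M" for t
      using that R_nonneg[of t] \<open>p > 1\<close> by (simp add: space_M powr_realpow')
    show "(LINT t|M. R t powr real p) = (LINT t|M. R t ^ p)"
      by (rule Bochner_Integration.integral_cong) (simp_all add: eq)
    have "integrable M (\<lambda>t. R t ^ p)"
      using R_int by (intro set_int) (simp add: I_def R_def)
    then show "integrable M (\<lambda>t. R t powr real p)"
      by (simp add: eq cong: Bochner_Integration.integrable_cong)
  qed
  have fq: "(f x ^ (p + 1)) powr q = f x powr s" if "x \<in> space M" for x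
    using that f_nonneg[of x] powr_realpow'[of "f x" "p + 1"]
    by (simp add: space_M I_def pq(4) add.commute flip: powr_powr)
  have fq_int: "integrable M (\<lambda>x. (f x ^ (p + 1)) powr q)"
    using fs_int by (simp only: fq cong: Bochner_Integration.integrable_cong)
  have fq_eq: "(LINT x|M. (f x ^ (p + 1)) powr q) = (LINT x|M. f x powr s)"
    by (rule Bochner_Integration.integral_cong) (simp_all only: fq)
  have f_nn: "f x ^ (p + 1) \<ge> 0" if "x \<in> space M" for x
    using that f_nonneg by (simp add: space_M I_def)
  have fp_meas: "(\<lambda>x. f x ^ (p + 1)) \<in> borel_measurable M" by simp
  have Rnn: "\<And>x. x \<in> space M \<Longrightarrow> R x \<ge> 0" by (simp add: space_M R_nonneg)
  note Hoelder = Hoelder_inequality[OF pq(1-3) R_meas fp_meas Rnn f_nn Rp_int fq_int]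

  have lhs_M: "integrable M (\<lambda>x. r x * F x ^ (p + 1))"
    using lhs_int by (intro set_int) (simp add: I_def F_def)
  have F_nonneg: "F x \<ge> 0" if "x \<in> I" for x
    unfolding F_def primitive_from_def set_lebesgue_integral_def
    using that by (intro integral_nonneg_AE AE_I2) (auto simp: I_def indicator_def intro!: f_nonneg)
  \<comment> \<open>Passing to nonnegative integrals reduces the exchange below to Tonelli's
    theorem, which asks only for joint measurability.\<close>
  have "ennreal (LINT x|M. r x * F x ^ (p + 1)) = (\<integral>\<^sup>+x. ennreal (r x * F x ^ (p + 1)) \<partial>M)"
    using lhs_M
    by (intro nn_integral_eq_integral[symmetric] AE_I2)
      (auto simp: space_M I_def less_imp_le r_pos intro!: F_nonneg mult_nonneg_nonneg zero_le_power)
  also have "\<dots> \<le> (\<integral>\<^sup>+x. (\<integral>\<^sup>+t. ennreal ((b - a) ^ p * (indicator {..<x} t * r x * f t ^ (p + 1))) \<partial>M) \<partial>M)"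
  proof (rule nn_integral_mono)
    fix x assume "x \<in> space M"
    then have x: "x \<in> I" by (simp add: space_M)
    then have rx: "r x \<ge> 0" using r_pos[of x] by (simp add: I_def)
    have int: "integrable M (\<lambda>t. indicator {..<x} t * f t ^ (p + 1))"
      by (rule Bochner_Integration.integrable_bound[OF fp_int]) (auto simp: indicator_def)
    have "r x * F x ^ (p + 1)
        \<le> r x * ((b - a) ^ p * (LINT t|M. indicator {..<x} t * f t ^ (p + 1)))"
      using F_le[OF x] rx by (rule mult_left_mono)
    also have "\<dots> = (LINT t|M. (b - a) ^ p * (indicator {..<x} t * r x * f t ^ (p + 1)))"
      by (simp add: mult_ac flip: integral_mult_right_zero)
    finally have "ennreal (r x * F x ^ (p + 1))
        \<le> ennreal (LINT t|M. (b - a) ^ p * (indicator {..<x} t * r x * f t ^ (p + 1)))"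
      by (rule ennreal_leI)
    also have "\<dots> = (\<integral>\<^sup>+t. ennreal ((b - a) ^ p * (indicator {..<x} t * r x * f t ^ (p + 1))) \<partial>M)"
    proof (rule nn_integral_eq_integral[symmetric])
      show "integrable M (\<lambda>t. (b - a) ^ p * (indicator {..<x} t * r x * f t ^ (p + 1)))"
        using integrable_mult_right[OF int, of "(b - a) ^ p * r x"] by (simp add: mult_ac)
      show "AE t in M. 0 \<le> (b - a) ^ p * (indicator {..<x} t * r x * f t ^ (p + 1))"
        using \<open>a < b\<close> rx f_nn by (intro AE_I2 mult_nonneg_nonneg) auto
    qed
    finally show "ennreal (r x * F x ^ (p + 1))
        \<le> (\<integral>\<^sup>+t. ennreal ((b - a) ^ p * (indicator {..<x} t * r x * f t ^ (p + 1))) \<partial>M)" .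
  qed
  also have "\<dots> = (\<integral>\<^sup>+t. (\<integral>\<^sup>+x. ennreal ((b - a) ^ p * (indicator {..<x} t * r x * f t ^ (p + 1))) \<partial>M) \<partial>M)"
    by (rule Fubini'[symmetric]) (simp add: indicator_def)
  also have "\<dots> = (\<integral>\<^sup>+t. ennreal ((b - a) ^ p * (R t * f t ^ (p + 1))) \<partial>M)"
  proof (rule nn_integral_cong)
    fix t assume t: "t \<in> space M"
    have c: "(b - a) ^ p * f t ^ (p + 1) \<ge> 0"
      using \<open>a < b\<close> f_nn[OF t] by (intro mult_nonneg_nonneg) auto
    \<comment> \<open>The condition \<open>t < x\<close> is now read as one on \<open>x\<close>:
      \<open>indicator {..<x} t\<close> equals \<open>indicator {t<..} x\<close>, and the factors
      depending on \<open>t\<close> alone leave the integral.\<close>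
    have "(\<integral>\<^sup>+x. ennreal ((b - a) ^ p * (indicator {..<x} t * r x * f t ^ (p + 1))) \<partial>M)
        = (\<integral>\<^sup>+x. ennreal ((b - a) ^ p * f t ^ (p + 1)) * ennreal (indicator {t<..} x * r x) \<partial>M)"
      by (intro nn_integral_cong) (simp only: ennreal_mult'[OF c, symmetric], simp add: indicator_def mult_ac)
    also have "\<dots> = ennreal ((b - a) ^ p * f t ^ (p + 1)) * ennreal (R t)"
      using t by (subst nn_integral_cmult) (auto simp: indicator_def R_eq space_M)
    also have "\<dots> = ennreal ((b - a) ^ p * (R t * f t ^ (p + 1)))"
      by (simp only: ennreal_mult'[OF c, symmetric], simp only: mult_ac)
    finally show "(\<integral>\<^sup>+x. ennreal ((b - a) ^ p * (indicator {..<x} t * r x * f t ^ (p + 1))) \<partial>M)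
        = ennreal ((b - a) ^ p * (R t * f t ^ (p + 1)))" .
  qed
  also have "\<dots> = ennreal (LINT t|M. (b - a) ^ p * (R t * f t ^ (p + 1)))"
    using Hoelder(1) \<open>a < b\<close> Rnn f_nn
    by (intro nn_integral_eq_integral AE_I2 mult_nonneg_nonneg integrable_mult_right) auto
  \<comment> \<open>The return to real integrals relies on the right-hand side being nonnegative,
    since \<open>ennreal\<close> truncates negative numbers to 0.\<close>
  finally have "(LINT x|M. r x * F x ^ (p + 1)) \<le> (LINT t|M. (b - a) ^ p * (R t * f t ^ (p + 1)))"
    using \<open>a < b\<close> Rnn f_nn
    by (subst (asm) ennreal_le_iff) (auto intro!: integral_nonneg_AE mult_nonneg_nonneg)
  also have "\<dots> \<le> (b - a) ^ p * ((LINT t|M. R t ^ p) powr (1 / real p)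
      * (LINT t|M. f t powr s) powr (1 / q))"
    using Hoelder(2) \<open>a < b\<close> unfolding Rp_eq fq_eq integral_mult_right_zero
    by (intro mult_left_mono) auto
  also have "\<dots> \<le> (real p + 1) powr (1 / real p) * ((b - a) ^ p * ((LINT t|M. R t ^ p) powr (1 / real p)
      * (LINT t|M. f t powr s) powr (1 / q)))"
  proof -
    \<comment> \<open>The base \<open>p + 1\<close> is at least 1 and the exponent is nonnegative,
      so this factor only enlarges the bound to the stated constant.\<close>
    have "X \<le> (real p + 1) powr (1 / real p) * X" if "X \<ge> 0" for X
      using mult_right_mono[OF ge_one_powr_ge_zero[of "real p + 1" "1 / real p"] that] by simp
    then show ?thesis using \<open>a < b\<close> by simp
  qed
  finally show ?thesis
    by (simp add: opial_const_def LINT_M[symmetric] I_def[symmetric] F_def R_def s_def pq(5) mult.assoc)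
qed

end
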